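(* Let $p\ge5$ be a prime, let $n\ge0$ be an integer, and let $T_n=\frac{1}{n+1}\binom{3n+1}{n}$. Then $$\nu_p(T_n)=\sum_{j\ge1}\mathbf{1}_{[n+1]_{p^j}\in I_{p^j}}.$$ In particular, $p\mid T_n$ if and only if $[n+1]_{p^j}\in I_{p^j}$ for at least one $j\ge1$.
   Context: $\nu_p(N)$ is the exponent of the largest power of $p$ dividing the positive integer $N$. $[x]_q$ denotes the least nonnegative residue of $x$ modulo $q$. For an odd integer $q\ge3$, $I_q$ is the set of integers $$I_q:=\left[\left\lceil\tfrac{q+2}{3}\right\rceil,\tfrac{q-1}{2}\right]\cup\left[\left\lceil\tfrac{2q+2}{3}\right\rceil,q-1\right],$$ where $[a,b]$ denotes the set of integers $t$ with $a\le t\le b$ (empty if $a>b$). For a statement $P$, $\mathbf{1}_P=1$ if $P$ is true and $0$ otherwise. *)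

theory Defs
  imports "HOL-Analysis.Infinite_Sum" "HOL-Computational_Algebra.Primes"
begin

(* The division is exact, see T_num_rational below. *)
definition T_num :: "nat \<Rightarrow> nat" where
  "T_num n = ((3 * n + 1) choose n) div (n + 1)"

lemma T_num_dvd: "(n + 1) dvd ((3 * n + 1) choose n)"
proof -
  have "(n + 1) * ((3 * n + 1) choose (n + 1)) = (2 * n + 1) * ((3 * n + 1) choose n)"
    using binomial_absorb_comp[of "3 * n + 1" n] binomial_absorption[of n "3 * n + 1"] by simp
  then have "(n + 1) dvd (2 * n + 1) * ((3 * n + 1) choose n)"
    by (metis dvd_triv_left)
  moreover have "coprime (n + 1) (2 * n + 1)"
  proof (rule coprimeI)
    fix d assume "d dvd n + 1" "d dvd 2 * n + 1"
    then have "d dvd 2 * (n + 1) - (2 * n + 1)"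
      using dvd_diff_nat dvd_mult by blast
    then show "is_unit d" by simp
  qed
  ultimately show ?thesis
    using coprime_dvd_mult_right_iff by blast
qed

lemma T_num_rational:
  "(of_nat (T_num n) :: rat) = 1 / of_nat (n + 1) * of_nat ((3 * n + 1) choose n)"
proof -
  have "(n + 1) * T_num n = (3 * n + 1) choose n"
    unfolding T_num_def by (rule dvd_mult_div_cancel[OF T_num_dvd])
  then have "(of_nat (n + 1) :: rat) * of_nat (T_num n) = of_nat ((3 * n + 1) choose n)"
    by (metis of_nat_mult)
  moreover have "(of_nat (n + 1) :: rat) \<noteq> 0"
    by (metis of_nat_eq_0_iff add_is_0 one_neq_zero)
  ultimately show ?thesis
    by (metis nonzero_mult_div_cancel_left times_divide_eq_left mult_1)
qed

(* Intended for odd q >= 3; then the division by 2 is exact. *)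
definition I_set :: "int \<Rightarrow> int set" where
  "I_set q = {\<lceil>(of_int (q + 2) :: rat) / 3\<rceil> .. (q - 1) div 2}
           \<union> {\<lceil>(of_int (2 * q + 2) :: rat) / 3\<rceil> .. q - 1}"

end

theory Submission
  imports Defs
begin

text \<open>Put \<open>m = n + 1\<close>. Then \<open>T\<^sub>n = (3m - 2)! / (m! (2m - 1)!)\<close>, so by Legendre's formula
  \<open>\<nu>\<^sub>p(T\<^sub>n)\<close> is the sum over \<open>q = p\<^sup>j\<close> of
  \<open>\<lfloor>(3m - 2)/q\<rfloor> - \<lfloor>m/q\<rfloor> - \<lfloor>(2m - 1)/q\<rfloor>\<close>. This difference depends only on the residue
  \<open>r\<close> of \<open>m\<close> modulo \<open>q\<close>: the first quotient jumps at \<open>r \<ge> (q + 2)/3\<close> and at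
  \<open>r \<ge> (2q + 2)/3\<close>, the last one at \<open>r \<ge> (q + 1)/2\<close>, so the difference is the
  indicator of \<open>r \<in> I\<^sub>q\<close>.\<close>

text \<open>The powers \<open>p ^ j\<close> dividing \<open>n\<close> are those with
  \<open>j\<close> at most the multiplicity \<open>k\<close>, and
  \<open>k < p ^ k \<le> n \<le> N\<close> ensures that the range misses none of them.\<close>

lemma multiplicity_eq_sum_of_bool:
  fixes p n N :: nat
  assumes "prime p" and "0 < n" and "n \<le> N"
  shows "multiplicity p n = (\<Sum>j = 1..N. of_bool (p ^ j dvd n))"
proof -
  have p: "\<not> is_unit p" "1 < p"
    using assms(1) prime_gt_1_nat by auto
  have "p ^ multiplicity p n \<le> n"
    using assms(2) by (intro dvd_imp_le multiplicity_dvd)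
  moreover have "multiplicity p n < p ^ multiplicity p n"
    using p(2) by (intro power_gt_expt) auto
  ultimately have le: "multiplicity p n \<le> N"
    using assms(3) by linarith
  have dvd_iff: "p ^ j dvd n \<longleftrightarrow> j \<le> multiplicity p n" for j
    using p assms(2) by (simp add: power_dvd_iff_le_multiplicity)
  have "{1..N} \<inter> {j. p ^ j dvd n} = {1..multiplicity p n}"
    unfolding dvd_iff using le by auto
  then show ?thesis
    by (simp add: sum_of_bool_eq)
qed

text \<open>Legendre's formula, by induction: passing to \<open>Suc n\<close> raises the quotient by
  \<open>q\<close> exactly when \<open>q\<close> divides \<open>Suc n\<close>. The free cutoff
  \<open>N\<close> lets several factorials share one summation range.\<close>

lemma multiplicity_fact_eq_sum_div:
  fixes p n N :: nat
  assumes "prime p" and "n \<le> N"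
  shows "multiplicity p (fact n) = (\<Sum>j = 1..N. n div p ^ j)"
  using assms(2)
proof (induction n)
  case 0
  then show ?case by simp
next
  case (Suc n)
  have "Suc n div q = of_bool (q dvd Suc n) + n div q" for q
    by (simp add: div_Suc dvd_eq_mod_eq_0)
  then have "(\<Sum>j = 1..N. Suc n div p ^ j)
      = multiplicity p (Suc n) + multiplicity p (fact n)"
    using Suc multiplicity_eq_sum_of_bool[OF assms(1), of "Suc n" N]
    by (simp add: sum.distrib)
  moreover have "multiplicity p (fact (Suc n))
      = multiplicity p (Suc n) + multiplicity p (fact n)"
    unfolding fact_Suc of_nat_id
    using assms(1) by (intro prime_elem_multiplicity_mult_distrib) auto
  ultimately show ?case by simp
qed

text \<open>Clearing the rational ceilings leaves integer inequalities within reach of linear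
  arithmetic.\<close>

lemma I_set_iff:
  "r \<in> I_set q \<longleftrightarrow>
     q + 2 \<le> 3 * r \<and> r \<le> (q - 1) div 2 \<or> 2 * q + 2 \<le> 3 * r \<and> r \<le> q - 1"
proof -
  have "\<lceil>(of_int a :: rat) / 3\<rceil> \<le> r \<longleftrightarrow> a \<le> 3 * r" for a
  proof -
    have "\<lceil>(of_int a :: rat) / 3\<rceil> \<le> r \<longleftrightarrow> (of_int a :: rat) \<le> of_int (3 * r)"
      by (simp add: ceiling_le_iff field_simps)
    then show ?thesis by (simp only: of_int_le_iff)
  qed
  then show ?thesis
    by (simp only: I_set_def Un_iff atLeastAtMost_iff)
qed

lemma div_diff_eq_of_bool_I_set:
  fixes m q :: int
  assumes "odd q" and "1 < q"
  shows "(3 * m - 2) div q = m div q + (2 * m - 1) div q + of_bool (m mod q \<in> I_set q)"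
proof -
  define a r where "a = m div q" and "r = m mod q"
  have m: "m = a * q + r"
    by (simp add: a_def r_def)
  have r: "0 \<le> r" "r < q"
    using assms by (auto simp: r_def)
  have eq: "3 * m - 2 = (3 * r - 2) + (3 * a) * q" "2 * m - 1 = (2 * r - 1) + (2 * a) * q"
    by (simp_all add: m algebra_simps)
  have div: "(3 * m - 2) div q = 3 * a + (3 * r - 2) div q"
      "(2 * m - 1) div q = 2 * a + (2 * r - 1) div q"
    unfolding eq using assms(2) by simp_all
  obtain k where k: "q = 2 * k + 1"
    using assms(1) by (elim oddE)
  have divI: "x div q = c" if "c * q \<le> x" "x < c * q + q" for x c
    using that by (intro int_div_pos_eq[of _ _ _ "x - c * q"]) (auto simp: algebra_simps)
  \<comment> \<open>With \<open>m = a * q + r\<close> the multiples of \<open>a\<close> cancel, so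
    only \<open>r\<close> remains. At \<open>r = 0\<close> the numerators \<open>-2\<close> and
    \<open>-1\<close> both have floor quotient \<open>-1\<close>, so they cancel too.\<close>
  have "(3 * r - 2) div q = (if r = 0 then - 1 else if 3 * r < q + 2 then 0
      else if 3 * r < 2 * q + 2 then 1 else 2)"
    by (rule divI; use assms(2) r k in auto)
  moreover have "(2 * r - 1) div q = (if r = 0 then - 1 else if r \<le> k then 0 else 1)"
    by (rule divI; use assms(2) r k in auto)
  ultimately have "(3 * r - 2) div q = (2 * r - 1) div q + of_bool (r \<in> I_set q)"
    using r k by (auto simp: I_set_iff)
  then show ?thesis
    unfolding div using a_def r_def by simp
qed

text \<open>A form without division, so that multiplicities simply add.\<close>

lemma T_num_fact:
  "fact (n + 1) * fact (2 * n + 1) * T_num n = fact (3 * n + 1)"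
proof -
  have "(n + 1) * T_num n = (3 * n + 1) choose n"
    unfolding T_num_def by (rule dvd_mult_div_cancel[OF T_num_dvd])
  moreover have "fact n * fact (2 * n + 1) * ((3 * n + 1) choose n) = fact (3 * n + 1)"
    using binomial_fact_lemma[of n "3 * n + 1"] by (simp add: numeral_eq_Suc)
  moreover have "fact (n + 1) = (n + 1) * (fact n :: nat)"
    by simp
  ultimately show ?thesis
    by (metis mult.assoc mult.commute)
qed

lemma multiplicity_T_num:
  fixes p n :: nat
  assumes "prime p" and "odd p"
  shows "multiplicity p (T_num n)
    = (\<Sum>j = 1..3 * n + 1. of_bool (int (n + 1) mod int p ^ j \<in> I_set (int p ^ j)))"
    (is "_ = (\<Sum>j = 1..?N. ?f j)")
proof -
  have summand: "?N div p ^ j = (n + 1) div p ^ j + (2 * n + 1) div p ^ j + ?f j"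
    if "1 \<le> j" for j
  proof -
    \<comment> \<open>The floor identity with \<open>m = n + 1\<close> lives over the integers,
      where subtraction is not truncated; it is then carried back to the naturals.\<close>
    have "(3 * int (n + 1) - 2) div int p ^ j = int (n + 1) div int p ^ j
        + (2 * int (n + 1) - 1) div int p ^ j + of_bool (int (n + 1) mod int p ^ j \<in> I_set (int p ^ j))"
      using assms that prime_gt_1_nat[OF assms(1)]
      by (intro div_diff_eq_of_bool_I_set one_less_power) auto
    moreover have "3 * int (n + 1) - 2 = int ?N" "2 * int (n + 1) - 1 = int (2 * n + 1)"
      by auto
    ultimately have "int (?N div p ^ j) = int ((n + 1) div p ^ j + (2 * n + 1) div p ^ j + ?f j)"
      by (simp only: zdiv_int of_nat_add of_nat_power of_nat_of_bool)
    then show ?thesis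
      by (simp only: of_nat_eq_iff)
  qed
  have pos: "T_num n \<noteq> 0"
    using T_num_fact[of n] by (metis fact_nonzero mult_0_right)
  have "multiplicity p (fact (n + 1)) + multiplicity p (fact (2 * n + 1)) + multiplicity p (T_num n)
      = multiplicity p (fact (n + 1) * fact (2 * n + 1) * T_num n)"
    using assms(1) pos by (simp add: prime_elem_multiplicity_mult_distrib del: fact_Suc)
  also have "\<dots> = (\<Sum>j = 1..?N. ?N div p ^ j)"
    unfolding T_num_fact by (rule multiplicity_fact_eq_sum_div[OF assms(1)]) simp
  also have "\<dots> = (\<Sum>j = 1..?N. (n + 1) div p ^ j) + (\<Sum>j = 1..?N. (2 * n + 1) div p ^ j)
      + (\<Sum>j = 1..?N. ?f j)"
    unfolding sum.distrib[symmetric] by (rule sum.cong) (simp_all only: summand atLeastAtMost_iff)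
  also have "(\<Sum>j = 1..?N. (n + 1) div p ^ j) = multiplicity p (fact (n + 1))"
    by (rule multiplicity_fact_eq_sum_div[OF assms(1), symmetric]) simp
  also have "(\<Sum>j = 1..?N. (2 * n + 1) div p ^ j) = multiplicity p (fact (2 * n + 1))"
    by (rule multiplicity_fact_eq_sum_div[OF assms(1), symmetric]) simp
  finally show ?thesis by linarith
qed

theorem proposition5p2:
  fixes p n :: nat
  assumes "prime p" and "p \<ge> 5"
  shows "((\<lambda>j. of_bool (int (n + 1) mod int p ^ j \<in> I_set (int p ^ j)))
            has_sum multiplicity p (T_num n)) {1..}
       \<and> (p dvd T_num n \<longleftrightarrow>
            (\<exists>j\<ge>1. int (n + 1) mod int p ^ j \<in> I_set (int p ^ j)))"
proof -
  let ?P = "\<lambda>j. int (n + 1) mod int p ^ j \<in> I_set (int p ^ j)"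
  let ?N = "3 * n + 1"
  have "odd p"
    using assms by (intro prime_odd_nat) auto
  note mult = multiplicity_T_num[OF assms(1) this, of n]
  \<comment> \<open>If \<open>3 * n + 1 < p ^ j\<close>, the residue is \<open>n + 1\<close> itself,
    and \<open>3 * (n + 1) < p ^ j + 2\<close> puts it just below the first interval.\<close>
  have le: "j \<le> ?N" if "?P j" for j
  proof (rule ccontr)
    assume "\<not> j \<le> ?N"
    moreover have "j < p ^ j"
      using assms(2) by (intro power_gt_expt) auto
    ultimately have "?N < p ^ j" by linarith
    then have "int ?N < int p ^ j"
      by (metis of_nat_less_iff of_nat_power)
    moreover from this have "int (n + 1) mod int p ^ j = int (n + 1)"
      by (intro mod_pos_pos_trivial) auto
    ultimately show False
      using that by (auto simp: I_set_iff)
  qed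
  have "((\<lambda>j. of_bool (?P j) :: nat) has_sum multiplicity p (T_num n)) {1..?N}"
    unfolding mult by (intro has_sum_finite) simp
  \<comment> \<open>All terms beyond \<open>?N\<close> vanish by \<open>le\<close>, so the finite
    sum is also the infinite one.\<close>
  then have sum: "((\<lambda>j. of_bool (?P j)) has_sum multiplicity p (T_num n)) {1..}"
    by (rule has_sum_cong_neutral[THEN iffD1, rotated -1]) (use le in \<open>auto simp del: of_nat_add\<close>)
  have "T_num n \<noteq> 0"
    using T_num_fact[of n] by (metis fact_nonzero mult_0_right)
  then have "p dvd T_num n \<longleftrightarrow> multiplicity p (T_num n) \<noteq> 0"
    using assms(1) by (metis multiplicity_gt_zero_iff neq0_conv not_prime_unit)
  also have "\<dots> \<longleftrightarrow> (\<exists>j\<ge>1. ?P j)"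
    unfolding mult by (subst sum_eq_0_iff) (use le in \<open>auto simp del: of_nat_add\<close>)
  finally show ?thesis
    using sum by blast
qed

end
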